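(* Let $k\ge 3$ and $n\ge 2$ be integers. Then $\mathcal{B}(k,n)\le \binom{k}{2}-1$.
   Context: An orthogonal array $\mathrm{OA}(k,n)$ on an alphabet $\Lambda$ with $|\Lambda|=n$ is an $n^2\times k$ matrix $A=(a_{r\ell})$ with entries in $\Lambda$ such that in every pair of distinct columns each ordered pair in $\Lambda^2$ occurs in exactly one row. For distinct columns $c,i,j\in\{1,\dots,k\}$ and $s\in\Lambda$, let $\rho_s(c,i,j)$ be the permutation of $\Lambda$ mapping $a_{ri}\mapsto a_{rj}$ for all rows $r$ with $a_{rc}=s$. With $\pi(\gamma)\in\mathbb{Z}_2$ denoting the parity of a permutation $\gamma$ ($0$ for even, $1$ for odd), define $\tau^c_{ij}(A)=\sum_{s\in\Lambda}\pi(\rho_s(c,i,j))\in\mathbb{Z}_2$. The $\tau$-parity of $A$ is the vector $(\tau^c_{ij}(A))$ indexed by the $k(k-1)(k-2)$ ordered triples $(c,i,j)$ of distinct elements of $\{1,\dots,k\}$. $\mathcal{B}(k,n)$ denotes $\log_2$ of the number of different $\tau$-parities achieved by orthogonal arrays $\mathrm{OA}(k,n)$ (on a fixed alphabet of size $n$); if no $\mathrm{OA}(k,n)$ exists we use the convention $\log_2 0=-\infty$. *)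

theory Defs
  imports
    "Jordan_Normal_Form.Matrix"
    "HOL-Combinatorics.Permutations"
    "HOL-Library.Z2"
    "HOL-Library.Extended_Real"
    "HOL-Library.FuncSet"
    Complex_Main
begin

text \<open>Rows and columns of matrices are numbered from \<open>0\<close>, so the columns
  \<open>{1,\<dots>,k}\<close> become \<open>{..<k}\<close>. The group of two elements is the type \<^typ>\<open>bit\<close>.\<close>

definition orthogonal_array :: "nat \<Rightarrow> nat \<Rightarrow> 'a set \<Rightarrow> 'a mat \<Rightarrow> bool" where
  "orthogonal_array k n \<Lambda> A \<longleftrightarrow>
     finite \<Lambda> \<and> card \<Lambda> = n \<and>
     A \<in> carrier_mat (n\<^sup>2) k \<and> elements_mat A \<subseteq> \<Lambda> \<and>
     (\<forall>i<k. \<forall>j<k. i \<noteq> j \<longrightarrow>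
        (\<forall>x\<in>\<Lambda>. \<forall>y\<in>\<Lambda>. \<exists>!r. r < n\<^sup>2 \<and> A $$ (r, i) = x \<and> A $$ (r, j) = y))"

text \<open>The permutation of \<open>\<Lambda>\<close> is extended by the identity to the whole type, as
  \<^const>\<open>permutes\<close> and \<^const>\<open>evenperm\<close> require; this does not affect its parity.\<close>

definition rho :: "'a set \<Rightarrow> 'a mat \<Rightarrow> 'a \<Rightarrow> nat \<Rightarrow> nat \<Rightarrow> nat \<Rightarrow> 'a \<Rightarrow> 'a" where
  "rho \<Lambda> A s c i j x =
     (if x \<in> \<Lambda> then A $$ ((THE r. r < dim_row A \<and> A $$ (r, c) = s \<and> A $$ (r, i) = x), j)
      else x)"

lemma rho_row:
  assumes oa: "orthogonal_array k n \<Lambda> A" and "c < k" "i < k" "c \<noteq> i"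
    and "r < n\<^sup>2"
  shows "rho \<Lambda> A (A $$ (r, c)) c i j (A $$ (r, i)) = A $$ (r, j)"
proof -
  have dim: "A \<in> carrier_mat (n\<^sup>2) k" "dim_row A = n\<^sup>2"
    using oa by (auto simp: orthogonal_array_def)
  have mem: "A $$ (r, c) \<in> \<Lambda>" "A $$ (r, i) \<in> \<Lambda>"
    using oa assms dim elements_matI[OF dim(1), of r] by (auto simp: orthogonal_array_def)
  then have "\<exists>!r'. r' < n\<^sup>2 \<and> A $$ (r', c) = A $$ (r, c) \<and> A $$ (r', i) = A $$ (r, i)"
    using oa assms by (simp add: orthogonal_array_def)
  then have "(THE r'. r' < dim_row A \<and> A $$ (r', c) = A $$ (r, c) \<and> A $$ (r', i) = A $$ (r, i)) = r"
    using \<open>r < n\<^sup>2\<close> dim(2) by (intro the1_equality) auto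
  then show ?thesis using mem by (simp add: rho_def)
qed

lemma rho_permutes:
  assumes oa: "orthogonal_array k n \<Lambda> A" and "c < k" "i < k" "j < k" "c \<noteq> i" "c \<noteq> j"
    and "s \<in> \<Lambda>"
  shows "rho \<Lambda> A s c i j permutes \<Lambda>"
proof -
  have dim: "A \<in> carrier_mat (n\<^sup>2) k" and fin: "finite \<Lambda>" and sub: "elements_mat A \<subseteq> \<Lambda>"
    using oa by (auto simp: orthogonal_array_def)
  have uniq: "\<exists>!r. r < n\<^sup>2 \<and> A $$ (r, c) = s \<and> A $$ (r, l) = x"
    if "l < k" "c \<noteq> l" "x \<in> \<Lambda>" for l x
    using oa \<open>c < k\<close> \<open>s \<in> \<Lambda>\<close> that by (simp add: orthogonal_array_def)
  have mem: "A $$ (r, j) \<in> \<Lambda>" if "r < n\<^sup>2" for r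
    using elements_matI[OF dim that \<open>j < k\<close> refl] sub by (rule rev_subsetD)
  have row: "\<exists>r<n\<^sup>2. A $$ (r, c) = s \<and> A $$ (r, i) = x \<and> rho \<Lambda> A s c i j x = A $$ (r, j)"
    if x: "x \<in> \<Lambda>" for x
  proof -
    obtain r where r: "r < n\<^sup>2" "A $$ (r, c) = s" "A $$ (r, i) = x"
      using ex1_implies_ex[OF uniq[OF \<open>i < k\<close> \<open>c \<noteq> i\<close> x]] by (elim exE conjE)
    then have "rho \<Lambda> A s c i j x = A $$ (r, j)"
      using rho_row[OF oa \<open>c < k\<close> \<open>i < k\<close> \<open>c \<noteq> i\<close> r(1), of j] by simp
    with r show ?thesis by (intro exI[of _ r]) simp
  qed
  have "inj_on (rho \<Lambda> A s c i j) \<Lambda>"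
  proof (rule inj_onI)
    fix x y assume xy: "x \<in> \<Lambda>" "y \<in> \<Lambda>" "rho \<Lambda> A s c i j x = rho \<Lambda> A s c i j y"
    obtain r where r: "r < n\<^sup>2" "A $$ (r, c) = s" "A $$ (r, i) = x" "rho \<Lambda> A s c i j x = A $$ (r, j)"
      using row[OF xy(1)] by (elim exE conjE)
    obtain r' where r': "r' < n\<^sup>2" "A $$ (r', c) = s" "A $$ (r', i) = y" "rho \<Lambda> A s c i j y = A $$ (r', j)"
      using row[OF xy(2)] by (elim exE conjE)
    have "r = r'"
      by (rule ex1E[OF uniq[OF \<open>j < k\<close> \<open>c \<noteq> j\<close> mem[OF r(1)]]])
         (use r r' xy(3) in metis)
    then show "x = y" using r r' by simp
  qed
  moreover have "rho \<Lambda> A s c i j ` \<Lambda> \<subseteq> \<Lambda>"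
  proof (rule image_subsetI)
    fix x assume "x \<in> \<Lambda>"
    from row[OF this] obtain r where "r < n\<^sup>2" "rho \<Lambda> A s c i j x = A $$ (r, j)"
      by (elim exE conjE)
    then show "rho \<Lambda> A s c i j x \<in> \<Lambda>" using mem by simp
  qed
  ultimately have "bij_betw (rho \<Lambda> A s c i j) \<Lambda> \<Lambda>"
    using fin by (simp add: bij_betw_def endo_inj_surj)
  then show ?thesis by (rule bij_imp_permutes) (simp add: rho_def)
qed

definition perm_parity :: "('a \<Rightarrow> 'a) \<Rightarrow> bit" where
  "perm_parity p = (if evenperm p then 0 else 1)"

definition tau :: "'a set \<Rightarrow> 'a mat \<Rightarrow> nat \<Rightarrow> nat \<Rightarrow> nat \<Rightarrow> bit" where
  "tau \<Lambda> A c i j = (\<Sum>s\<in>\<Lambda>. perm_parity (rho \<Lambda> A s c i j))"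

definition distinct_triples :: "nat \<Rightarrow> (nat \<times> nat \<times> nat) set" where
  "distinct_triples k = {(c, i, j). c < k \<and> i < k \<and> j < k \<and> c \<noteq> i \<and> c \<noteq> j \<and> i \<noteq> j}"

text \<open>The restriction makes two vectors equal exactly when they agree on all triples
  of distinct columns.\<close>

definition tau_parity :: "nat \<Rightarrow> 'a set \<Rightarrow> 'a mat \<Rightarrow> nat \<times> nat \<times> nat \<Rightarrow> bit" where
  "tau_parity k \<Lambda> A = (\<lambda>(c, i, j)\<in>distinct_triples k. tau \<Lambda> A c i j)"

definition tau_parities :: "nat \<Rightarrow> nat \<Rightarrow> 'a set \<Rightarrow> (nat \<times> nat \<times> nat \<Rightarrow> bit) set" where
  "tau_parities k n \<Lambda> = {tau_parity k \<Lambda> A | A. orthogonal_array k n \<Lambda> A}"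

text \<open>\<^const>\<open>card\<close> returns \<open>0\<close> on infinite sets, so finiteness matters for \<open>\<B>\<close> below.\<close>

lemma finite_tau_parities: "finite (tau_parities k n \<Lambda>)"
proof (rule finite_subset)
  show "tau_parities k n \<Lambda> \<subseteq> distinct_triples k \<rightarrow>\<^sub>E UNIV"
    unfolding tau_parities_def tau_parity_def by (auto simp: PiE_def)
  have "distinct_triples k \<subseteq> {..<k} \<times> {..<k} \<times> {..<k}"
    by (auto simp: distinct_triples_def)
  then have "finite (distinct_triples k)" by (rule finite_subset) simp
  moreover have "finite (UNIV :: bit set)"
  proof (rule finite_subset)
    show "(UNIV :: bit set) \<subseteq> {0, 1}" using bit_not_one_iff by blast
  qed simp
  ultimately show "finite (distinct_triples k \<rightarrow>\<^sub>E (UNIV :: bit set))"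
    by (intro finite_PiE) auto
qed

definition \<B> :: "nat \<Rightarrow> nat \<Rightarrow> 'a set \<Rightarrow> ereal" where
  "\<B> k n \<Lambda> =
     (if tau_parities k n \<Lambda> = {} then -\<infinity> else ereal (log 2 (real (card (tau_parities k n \<Lambda>)))))"

end

theory Submission
  imports Defs
begin

text \<open>Write \<open>e\<^bsub>ci\<^esub>\<close> for the bijection from rows to \<open>\<Lambda> \<times> \<Lambda>\<close> given by columns \<open>c\<close> and \<open>i\<close>.
  Then \<open>\<tau>\<^bsup>c\<^esup>\<^bsub>ij\<^esub>\<close> is the parity of the permutation \<open>e\<^bsub>cj\<^esub> \<circ> e\<^bsub>ci\<^esub>\<inverse>\<close> of \<open>\<Lambda> \<times> \<Lambda>\<close>, and \<open>e\<^bsub>ic\<^esub>\<close> is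
  \<open>e\<^bsub>ci\<^esub>\<close> followed by the swap of coordinates. Going around a triple of columns gives
  \<open>\<tau>\<^bsup>c\<^esup>\<^bsub>ij\<^esub> + \<tau>\<^bsup>i\<^esup>\<^bsub>jc\<^esub> + \<tau>\<^bsup>j\<^esup>\<^bsub>ci\<^esub> = \<sigma>\<close>, where \<open>\<sigma>\<close> is the parity of the swap. For fixed \<open>c\<close> also
  \<open>\<tau>\<^bsup>c\<^esup>\<^bsub>ij\<^esub> + \<tau>\<^bsup>c\<^esup>\<^bsub>jl\<^esub> = \<tau>\<^bsup>c\<^esup>\<^bsub>il\<^esub>\<close>, so \<open>\<tau>\<^bsup>c\<^esup>\<^bsub>ij\<^esub> = h\<^sub>c(i) + h\<^sub>c(j)\<close> for a potential \<open>h\<^sub>c\<close> that is unique up to an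
  additive constant. These constants can be chosen such that \<open>h\<^sub>i(j) + h\<^sub>j(i) = \<sigma>\<close> for all \<open>i \<noteq> j\<close> and
  \<open>h\<^sub>0(1) = 0\<close>; the remaining freedom is one bit for each pair \<open>i < j\<close> other than \<open>(0, 1)\<close>.\<close>

text \<open>As a simp rule this rewrites sums in \<^typ>\<open>bit\<close> to case distinctions on equality with \<open>1\<close>.\<close>

declare add_bit_eq_xor [simp del]

section \<open>Parities of permutations acting on pairs\<close>

lemma perm_parity_id [simp]: "perm_parity id = 0" "perm_parity (\<lambda>x. x) = 0"
  by (simp_all add: perm_parity_def)

lemma perm_parity_compose:
  assumes "permutation p" "permutation q"
  shows "perm_parity (p \<circ> q) = perm_parity p + perm_parity q"
  using assms by (simp add: perm_parity_def evenperm_comp)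

lemma bit_add_self [simp]: "a + a = 0" "a + (a + b) = b" for a b :: bit
  by (cases a; cases b; simp)+

lemma bit_add_eq_0_iff: "a + b = 0 \<longleftrightarrow> a = b" for a b :: bit
  by (cases a; cases b) simp_all

text \<open>With \<open>rho\<close> as the family over the alphabet this is the permutation of pairs
  in the overview, extended by the identity.\<close>

definition fibre_map :: "'b set \<Rightarrow> ('b \<Rightarrow> 'a \<Rightarrow> 'a) \<Rightarrow> 'b \<times> 'a \<Rightarrow> 'b \<times> 'a" where
  "fibre_map S p = (\<lambda>(s, x). (s, if s \<in> S then p s x else x))"

lemma fibre_map_insert:
  assumes "s \<notin> S"
  shows "fibre_map (insert s S) p = fibre_map {s} p \<circ> fibre_map S p"
  using assms by (auto simp: fibre_map_def fun_eq_iff)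

text \<open>By induction over transpositions: lifting a transposition to one fibre gives a
  transposition of pairs. The family is constant so that the induction can vary
  \<open>q\<close>.\<close>

lemma fibre_map_single:
  assumes "q permutes L" "finite L"
  shows "permutation (fibre_map {s} (\<lambda>_. q)) \<and>
    perm_parity (fibre_map {s} (\<lambda>_. q)) = perm_parity q"
  using assms
proof (induction rule: permutes_induct)
  case id
  have "fibre_map {s} (\<lambda>_. id) = (id :: 'b \<times> 'a \<Rightarrow> _)"
    by (auto simp: fibre_map_def fun_eq_iff)
  then show ?case by (simp only: permutation_id perm_parity_id simp_thms)
next
  case (swap a b q)
  have eq: "fibre_map {s} (\<lambda>_. transpose a b \<circ> q)
      = transpose (s, a) (s, b) \<circ> fibre_map {s} (\<lambda>_. q)"
    by (auto simp: fibre_map_def fun_eq_iff transpose_def)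
  have "permutation q" using swap assms by (auto simp: permutation_permutes)
  moreover have "perm_parity (transpose (s, a) (s, b)) = perm_parity (transpose a b)"
    by (simp add: perm_parity_def evenperm_swap)
  ultimately show ?case
    using swap perm_parity_compose permutation_compose permutation_swap_id unfolding eq by metis
qed

lemma fibre_map_parity:
  assumes "finite S" "finite L" "\<And>s. s \<in> S \<Longrightarrow> p s permutes L"
  shows "permutation (fibre_map S p) \<and> perm_parity (fibre_map S p) = (\<Sum>s\<in>S. perm_parity (p s))"
  using assms(1,3)
proof (induction rule: finite_induct)
  case empty
  have "fibre_map {} p = id" by (auto simp: fibre_map_def fun_eq_iff)
  then show ?case by simp
next
  case (insert s S)
  have "fibre_map {s} p = fibre_map {s} (\<lambda>_. p s)" by (auto simp: fibre_map_def fun_eq_iff)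
  with fibre_map_single[of "p s" L s] insert.prems assms(2)
  have "permutation (fibre_map {s} p)" "perm_parity (fibre_map {s} p) = perm_parity (p s)" by auto
  then show ?case
    using insert unfolding fibre_map_insert[OF insert.hyps(2)]
    by (simp add: perm_parity_compose permutation_compose del: comp_apply)
qed

text \<open>Being the identity off the square gives finite support on any type when \<open>L\<close>
  is finite, as \<open>permutation\<close> requires.\<close>

definition square_swap :: "'a set \<Rightarrow> 'a \<times> 'a \<Rightarrow> 'a \<times> 'a" where
  "square_swap L z = (if z \<in> L \<times> L then prod.swap z else z)"

lemma permutation_square_swap:
  assumes "finite L"
  shows "permutation (square_swap L)"
proof -
  have "bij_betw (square_swap L) (L \<times> L) (L \<times> L)"
    by (rule bij_betw_byWitness[of _ "square_swap L"]) (auto simp: square_swap_def)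
  then have "square_swap L permutes (L \<times> L)"
    by (rule bij_imp_permutes) (auto simp: square_swap_def)
  then show ?thesis using assms by (auto simp: permutation_permutes)
qed

section \<open>Relations between the \<tau>-values of one array\<close>

context
  fixes k n :: nat and \<Lambda> :: "'a set" and A :: "'a mat"
  assumes oa: "orthogonal_array k n \<Lambda> A"
begin

lemma finite_alphabet: "finite \<Lambda>"
  using oa by (simp add: orthogonal_array_def)

lemma entry_mem: "r < n\<^sup>2 \<Longrightarrow> i < k \<Longrightarrow> A $$ (r, i) \<in> \<Lambda>"
  using oa elements_matI[of A "n\<^sup>2" k r i] by (auto simp: orthogonal_array_def)

lemma obtain_row:
  assumes "c < k" "i < k" "c \<noteq> i" "s \<in> \<Lambda>" "x \<in> \<Lambda>"
  obtains r where "r < n\<^sup>2" "A $$ (r, c) = s" "A $$ (r, i) = x"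
  using oa assms unfolding orthogonal_array_def by blast

lemma rho_compose:
  assumes "c < k" "i < k" "j < k" "c \<noteq> i" "c \<noteq> j" "s \<in> \<Lambda>"
  shows "rho \<Lambda> A s c j l \<circ> rho \<Lambda> A s c i j = rho \<Lambda> A s c i l"
proof
  fix x
  show "(rho \<Lambda> A s c j l \<circ> rho \<Lambda> A s c i j) x = rho \<Lambda> A s c i l x"
  proof (cases "x \<in> \<Lambda>")
    case True
    then obtain r where r: "r < n\<^sup>2" and s: "s = A $$ (r, c)" and x: "x = A $$ (r, i)"
      using obtain_row assms by metis
    show ?thesis
      unfolding s x using r assms by (simp add: rho_row[OF oa])
  qed (simp add: rho_def)
qed

text \<open>The columns \<open>i\<close>, \<open>j\<close>, \<open>l\<close> may coincide; such
  instances yield \<open>tau_refl\<close> and \<open>tau_commute\<close>.\<close>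

lemma tau_cocycle:
  assumes "c < k" "i < k" "j < k" "l < k" "c \<noteq> i" "c \<noteq> j" "c \<noteq> l"
  shows "tau \<Lambda> A c i l = tau \<Lambda> A c i j + tau \<Lambda> A c j l"
proof -
  have "perm_parity (rho \<Lambda> A s c i l) = perm_parity (rho \<Lambda> A s c i j) + perm_parity (rho \<Lambda> A s c j l)"
    if s: "s \<in> \<Lambda>" for s
  proof -
    have "permutation (rho \<Lambda> A s c i j)" "permutation (rho \<Lambda> A s c j l)"
      using rho_permutes[OF oa] assms s finite_alphabet by (auto simp: permutation_permutes)
    then show ?thesis
      using rho_compose[of c i j s l] assms s perm_parity_compose by (metis add.commute)
  qed
  then show ?thesis by (simp add: tau_def sum.distrib)
qed

lemma tau_refl:
  assumes "c < k" "i < k" "c \<noteq> i"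
  shows "tau \<Lambda> A c i i = 0"
  using tau_cocycle[of c i i i] assms by simp

lemma tau_commute:
  assumes "c < k" "i < k" "j < k" "c \<noteq> i" "c \<noteq> j"
  shows "tau \<Lambda> A c i j = tau \<Lambda> A c j i"
  using tau_cocycle[of c i j i] tau_refl[of c i] assms by (simp add: bit_add_eq_0_iff)

lemma tau_triangle:
  assumes "c < k" "i < k" "j < k" "c \<noteq> i" "c \<noteq> j" "i \<noteq> j"
  shows "tau \<Lambda> A c i j + tau \<Lambda> A i j c + tau \<Lambda> A j c i = perm_parity (square_swap \<Lambda>)"
proof -
  define \<phi> where "\<phi> c i j = fibre_map \<Lambda> (\<lambda>s. rho \<Lambda> A s c i j)" for c i j
  let ?\<sigma> = "square_swap \<Lambda>"
  have par: "permutation (\<phi> c i j)" "perm_parity (\<phi> c i j) = tau \<Lambda> A c i j"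
    if "c < k" "i < k" "j < k" "c \<noteq> i" "c \<noteq> j" for c i j
    using fibre_map_parity[OF finite_alphabet finite_alphabet, of "\<lambda>s. rho \<Lambda> A s c i j"]
      rho_permutes[OF oa that]
    by (auto simp: \<phi>_def tau_def)
  have row: "\<phi> c i j (A $$ (r, c), A $$ (r, i)) = (A $$ (r, c), A $$ (r, j))"
    if "c < k" "i < k" "c \<noteq> i" "r < n\<^sup>2" for c i j r
    using that entry_mem rho_row[OF oa] by (simp add: \<phi>_def fibre_map_def)
  have off: "\<phi> c i j z = z" if "z \<notin> \<Lambda> \<times> \<Lambda>" for c i j z
    using that by (cases z) (auto simp: \<phi>_def fibre_map_def rho_def)
  \<comment> \<open>On the entries of one row, the rightmost factor sends (c,i) via (c,j) to (j,c),
    the next via (j,i) to (i,j), the last via (i,c) back to (c,i).\<close>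
  have "?\<sigma> \<circ> \<phi> i j c \<circ> (?\<sigma> \<circ> \<phi> j c i) \<circ> (?\<sigma> \<circ> \<phi> c i j) = id" (is "?f = _")
  proof
    fix z
    show "?f z = id z"
    proof (cases "z \<in> \<Lambda> \<times> \<Lambda>")
      case True
      then obtain r where r: "r < n\<^sup>2" and z: "z = (A $$ (r, c), A $$ (r, i))"
        using obtain_row[of c i "fst z" "snd z"] assms by (metis mem_Times_iff prod.collapse)
      have sw: "?\<sigma> (A $$ (r, a), A $$ (r, b)) = (A $$ (r, b), A $$ (r, a))" if "a < k" "b < k" for a b
        using that r entry_mem by (simp add: square_swap_def)
      show ?thesis
        unfolding z using r assms by (simp add: row sw)
    next
      case False
      then show ?thesis by (simp add: off square_swap_def)
    qed
  qed
  then have "perm_parity ?f = 0" by (simp add: perm_parity_def)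
  moreover have "permutation ?\<sigma>" by (rule permutation_square_swap[OF finite_alphabet])
  \<comment> \<open>The swap occurs three times, so modulo 2 its parity survives once.\<close>
  ultimately have "(perm_parity ?\<sigma> + tau \<Lambda> A i j c) + (perm_parity ?\<sigma> + tau \<Lambda> A j c i)
      + (perm_parity ?\<sigma> + tau \<Lambda> A c i j) = 0"
    using par[of i j c] par[of j c i] par[of c i j] assms
    by (simp add: perm_parity_compose permutation_compose)
  then show ?thesis
    by (cases "perm_parity ?\<sigma>"; cases "tau \<Lambda> A i j c"; cases "tau \<Lambda> A j c i"; cases "tau \<Lambda> A c i j")
      simp_all
qed

lemma tau_potential:
  assumes "k \<ge> 2"
  obtains h :: "nat \<Rightarrow> nat \<Rightarrow> bit" where
    "\<And>c i j. (c, i, j) \<in> distinct_triples k \<Longrightarrow> tau \<Lambda> A c i j = h c i + h c j"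
    "\<And>i j. i < k \<Longrightarrow> j < k \<Longrightarrow> i \<noteq> j \<Longrightarrow> h i j + h j i = perm_parity (square_swap \<Lambda>)"
    "h 0 1 = 0"
proof -
  let ?\<sigma> = "perm_parity (square_swap \<Lambda>)"
  \<comment> \<open>Potentials based at column 1 for \<open>i = 0\<close> and at column 0 otherwise.
    Since \<open>tau\<close> vanishes at the base, the constant added for \<open>i\<close> nonzero
    is forced by \<open>h 0 i + h i 0 = ?\<sigma>\<close>.\<close>
  define h where "h i j =
    (if i = 0 then tau \<Lambda> A 0 1 j else tau \<Lambda> A i 0 j + ?\<sigma> + tau \<Lambda> A 0 1 i)" for i j
  have h01: "h 0 1 = 0"
    using assms tau_refl[of 0 1] by (simp add: h_def)
  have pot: "tau \<Lambda> A c i j = h c i + h c j" if "(c, i, j) \<in> distinct_triples k" for c i j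
  proof -
    define b where "b = (if c = 0 then 1 else (0::nat))"
    have *: "c < k" "i < k" "j < k" "b < k" "c \<noteq> i" "c \<noteq> j" "c \<noteq> b"
      using that assms by (auto simp: distinct_triples_def b_def)
    have "tau \<Lambda> A c i j = tau \<Lambda> A c b i + tau \<Lambda> A c b j"
      using tau_cocycle[of c i b j] tau_commute[of c i b] * by simp
    also have "\<dots> = h c i + h c j"
      by (cases ?\<sigma>; cases "tau \<Lambda> A 0 1 c") (auto simp: h_def b_def)
    finally show ?thesis .
  qed
  have zero: "h 0 j + h j 0 = ?\<sigma>" if "j < k" "j \<noteq> 0" for j
    using that tau_refl[of j 0]
    by (cases ?\<sigma>; cases "tau \<Lambda> A 0 1 j") (auto simp: h_def)
  have anti: "h i j + h j i = ?\<sigma>" if ij: "i < k" "j < k" "i \<noteq> j" for i j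
  proof (cases "i = 0 \<or> j = 0")
    case True
    then show ?thesis using zero[of i] zero[of j] ij by (auto simp: add.commute)
  next
    case False
    \<comment> \<open>The two copies of \<open>?\<sigma>\<close> in \<open>h i j + h j i\<close>
      cancel, and the terms at column 0 add up to \<open>tau \<Lambda> A 0 i j\<close>, leaving this
      triangle sum.\<close>
    have "tau \<Lambda> A 0 i j + tau \<Lambda> A i 0 j + tau \<Lambda> A j 0 i = ?\<sigma>"
      using tau_triangle[of 0 i j] tau_commute[of i j 0] ij False by simp
    moreover have "tau \<Lambda> A 0 i j = tau \<Lambda> A 0 1 i + tau \<Lambda> A 0 1 j"
      using tau_cocycle[of 0 i 1 j] tau_commute[of 0 i 1] ij False by simp
    ultimately show ?thesis
      using False
      by (cases ?\<sigma>; cases "tau \<Lambda> A 0 1 i"; cases "tau \<Lambda> A 0 1 j"; cases "tau \<Lambda> A i 0 j";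
          cases "tau \<Lambda> A j 0 i") (auto simp: h_def)
  qed
  show ?thesis by (rule that[OF pot anti h01])
qed

end

section \<open>Counting the potentials\<close>

lemma card_ordered_pairs: "card {(i, j). i < j \<and> j < k} = k choose 2" for k :: nat
proof -
  have "{(i, j). i < j \<and> j < k} = prod.swap ` (SIGMA j:{..<k}. {..<j})"
    by force
  then have "card {(i, j). i < j \<and> j < k} = card (SIGMA j:{..<k}. {..<j})"
    by (simp add: card_image)
  also have "\<dots> = (\<Sum>j<k. j)"
    by (simp add: card_SigmaI)
  also have "\<dots> = k choose 2"
    by (induction k) (simp_all add: numeral_2_eq_2)
  finally show ?thesis .
qed

lemma card_tau_parities_le:
  assumes "k \<ge> 2"
  shows "card (tau_parities k n \<Lambda>) \<le> 2 ^ ((k choose 2) - 1)"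
proof -
  let ?\<sigma> = "perm_parity (square_swap \<Lambda>)"
  define E where "E = {(i, j). i < j \<and> j < k} - {(0, 1)}"
  \<comment> \<open>Rebuilds a potential from its free bits on \<open>E\<close>. The last default is
    the forced value at (1, 0); other pairs reaching it are diagonal or out of range.\<close>
  define h :: "(nat \<times> nat \<Rightarrow> bit) \<Rightarrow> nat \<Rightarrow> nat \<Rightarrow> bit" where
    "h f i j = (if (i, j) \<in> E then f (i, j) else if (i, j) = (0, 1) then 0
       else if (j, i) \<in> E then ?\<sigma> + f (j, i) else ?\<sigma>)" for f i j
  define T where "T f = (\<lambda>(c, i, j)\<in>distinct_triples k. h f c i + h f c j)" for f
  have "{(i, j). i < j \<and> j < k} \<subseteq> {..<k} \<times> {..<k}" by auto
  then have fin: "finite {(i, j). i < j \<and> j < k}" by (rule finite_subset) simp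
  then have E: "finite E" "card E = (k choose 2) - 1"
    using assms by (simp_all add: E_def card_ordered_pairs)
  have U: "(UNIV :: bit set) = {0, 1}" using bit_not_one_iff by blast
  have fin_funs: "finite (E \<rightarrow>\<^sub>E (UNIV :: bit set))"
    using E(1) by (intro finite_PiE) (simp_all add: U)
  have card_funs: "card (E \<rightarrow>\<^sub>E (UNIV :: bit set)) = 2 ^ ((k choose 2) - 1)"
    using E by (simp add: card_PiE U numeral_2_eq_2)
  have "tau_parities k n \<Lambda> \<subseteq> T ` (E \<rightarrow>\<^sub>E UNIV)"
  proof
    fix t assume "t \<in> tau_parities k n \<Lambda>"
    then obtain A where oa: "orthogonal_array k n \<Lambda> A" and t: "t = tau_parity k \<Lambda> A"
      by (auto simp: tau_parities_def)
    obtain g where g: "\<And>c i j. (c, i, j) \<in> distinct_triples k \<Longrightarrow> tau \<Lambda> A c i j = g c i + g c j"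
      "\<And>i j. i < k \<Longrightarrow> j < k \<Longrightarrow> i \<noteq> j \<Longrightarrow> g i j + g j i = ?\<sigma>" "g 0 1 = 0"
    proof (rule tau_potential[OF oa assms], goal_cases)
      case (1 g)
      show ?case by (rule 1(1)[OF 1(2,3,4)])
    qed
    have h: "h (restrict (\<lambda>(i, j). g i j) E) i j = g i j" if "i < k" "j < k" "i \<noteq> j" for i j
    proof -
      have "g i j = ?\<sigma> + g j i"
        using g(2)[OF that] by (cases "g i j"; cases "g j i"; cases ?\<sigma>) simp_all
      moreover have "(i, j) \<in> E \<or> (j, i) \<in> E \<or> (i, j) = (0, 1) \<or> (j, i) = (0, 1)"
        using that by (auto simp: E_def)
      moreover have "(i, j) \<notin> E \<or> (j, i) \<notin> E" "(0, 1) \<notin> E" "(1, 0) \<notin> E" by (auto simp: E_def)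
      ultimately show ?thesis
        using g(3) unfolding h_def by (elim disjE) (simp_all, blast)
    qed
    have "t = T (restrict (\<lambda>(i, j). g i j) E)"
      unfolding t T_def tau_parity_def
    proof (rule restrict_ext, clarify)
      fix c i j assume "(c, i, j) \<in> distinct_triples k"
      moreover from this have "c < k" "i < k" "j < k" "c \<noteq> i" "c \<noteq> j"
        by (simp_all add: distinct_triples_def)
      ultimately show "tau \<Lambda> A c i j
          = h (restrict (\<lambda>(i, j). g i j) E) c i + h (restrict (\<lambda>(i, j). g i j) E) c j"
        by (simp only: h g(1) simp_thms not_False_eq_True)
    qed
    moreover have "restrict (\<lambda>(i, j). g i j) E \<in> E \<rightarrow>\<^sub>E UNIV"
      by (simp add: restrict_PiE_iff)
    ultimately show "t \<in> T ` (E \<rightarrow>\<^sub>E UNIV)" by (simp only: image_eqI)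
  qed
  from surj_card_le[OF fin_funs this] show ?thesis by (simp only: card_funs)
qed

theorem corollary4p3:
  fixes k n :: nat and \<Lambda> :: "'a set"
  assumes "k \<ge> 3" and "n \<ge> 2"
    and "finite \<Lambda>" and "card \<Lambda> = n"
  shows "\<B> k n \<Lambda> \<le> ereal (real (k choose 2) - 1)"
proof (cases "tau_parities k n \<Lambda> = {}")
  case True
  then show ?thesis by (simp add: \<B>_def)
next
  case False
  then have pos: "card (tau_parities k n \<Lambda>) > 0"
    by (simp add: card_gt_0_iff finite_tau_parities)
  \<comment> \<open>Makes the truncated subtraction in the exponent agree with the real one.\<close>
  have "k choose 2 > 0" using assms by simp
  have "real (card (tau_parities k n \<Lambda>)) \<le> 2 ^ ((k choose 2) - 1)"
    using of_nat_mono[OF card_tau_parities_le[of k n \<Lambda>], where 'a = real] assms by simp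
  then have "log 2 (real (card (tau_parities k n \<Lambda>))) \<le> log 2 (2 ^ ((k choose 2) - 1))"
    using pos by (subst log_le_cancel_iff) auto
  also have "\<dots> = real (k choose 2) - 1"
    using \<open>k choose 2 > 0\<close> by (simp add: log_nat_power of_nat_diff Suc_le_eq)
  finally show ?thesis using False by (simp add: \<B>_def)
qed

end
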